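(* For a $k$-uniform hypergraph $G(V,E)$, $\chi(G)\ge \frac{|V|}{2\gamma(G)}$.
   Context: $\chi(G)$ is the minimum number of colors in a vertex coloring of $G$ with no monochromatic hyperedge. A bicoloring of $G$ is a map $X:V\to\{0,1\}$; a bicoloring cover of $G$ is a set of bicolorings such that every hyperedge is non-monochromatic under at least one of them; $\chi^c(G)$ is the minimum size of a bicoloring cover. For an optimal bicoloring cover $C=\{X_1,\dots,X_{\chi^c(G)}\}$, each vertex $v$ gets the color bit vector $(X_1(v),\dots,X_{\chi^c(G)}(v))$, and $\gamma_C(G)$ is the maximum number of vertices sharing a common bit vector. The cover independence number $\gamma(G)$ is the maximum of $\gamma_C(G)$ over all bicoloring covers $C$ of size $\chi^c(G)$. *)

theory Defs
  imports Complex_Main "HOL-Library.FuncSet"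
begin

definition uniform_hypergraph :: "nat \<Rightarrow> 'a set \<Rightarrow> 'a set set \<Rightarrow> bool" where
  "uniform_hypergraph k V E \<longleftrightarrow> finite V \<and> (\<forall>e\<in>E. e \<subseteq> V \<and> card e = k)"

definition monochromatic :: "('a \<Rightarrow> nat) \<Rightarrow> 'a set \<Rightarrow> bool" where
  "monochromatic f e \<longleftrightarrow> (\<exists>c. \<forall>v\<in>e. f v = c)"

definition proper_coloring :: "'a set \<Rightarrow> 'a set set \<Rightarrow> nat \<Rightarrow> ('a \<Rightarrow> nat) \<Rightarrow> bool" where
  "proper_coloring V E n f \<longleftrightarrow> f \<in> V \<rightarrow>\<^sub>E {..<n} \<and> (\<forall>e\<in>E. \<not> monochromatic f e)"

(* Meaningful when some proper coloring exists; for finite V this holds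
   as soon as every hyperedge has at least two vertices. *)
definition chromatic_number :: "'a set \<Rightarrow> 'a set set \<Rightarrow> nat" where
  "chromatic_number V E = (LEAST n. \<exists>f. proper_coloring V E n f)"

(* Extensional functions, so that a set of bicolorings is counted by
   the values taken on V only. *)
definition bicolorings :: "'a set \<Rightarrow> ('a \<Rightarrow> nat) set" where
  "bicolorings V = V \<rightarrow>\<^sub>E {0, 1}"

definition bicoloring_cover :: "'a set \<Rightarrow> 'a set set \<Rightarrow> ('a \<Rightarrow> nat) set \<Rightarrow> bool" where
  "bicoloring_cover V E C \<longleftrightarrow>
     finite C \<and> C \<subseteq> bicolorings V \<and> (\<forall>e\<in>E. \<exists>X\<in>C. \<not> monochromatic X e)"

definition bicoloring_cover_number :: "'a set \<Rightarrow> 'a set set \<Rightarrow> nat" where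
  "bicoloring_cover_number V E = (LEAST n. \<exists>C. bicoloring_cover V E C \<and> card C = n)"

definition optimal_cover :: "'a set \<Rightarrow> 'a set set \<Rightarrow> ('a \<Rightarrow> nat) set \<Rightarrow> bool" where
  "optimal_cover V E C \<longleftrightarrow> bicoloring_cover V E C \<and> card C = bicoloring_cover_number V E"

(* The bits are indexed by the bicolorings themselves instead of by an
   enumeration X_1, ..., X_t of C; the order of the bits is irrelevant below. *)
definition color_vector :: "('a \<Rightarrow> nat) set \<Rightarrow> 'a \<Rightarrow> (('a \<Rightarrow> nat) \<Rightarrow> nat)" where
  "color_vector C v = (\<lambda>X\<in>C. X v)"

definition cover_gamma :: "'a set \<Rightarrow> ('a \<Rightarrow> nat) set \<Rightarrow> nat" where
  "cover_gamma V C = Max ((\<lambda>b. card {v \<in> V. color_vector C v = b}) ` (C \<rightarrow>\<^sub>E {0, 1}))"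

definition cover_independence_number :: "'a set \<Rightarrow> 'a set set \<Rightarrow> nat" where
  "cover_independence_number V E = Max (cover_gamma V ` {C. optimal_cover V E C})"

end

theory Submission imports Defs begin

text \<open>Let \<open>2 ^ t\<close> be the power of two in the interval from \<open>\<chi>\<close> (exclusive) to \<open>2 \<chi>\<close> (inclusive).
  The \<open>t\<close> binary digits of an optimal colouring form a bicoloring cover, so an optimal cover has at
  most \<open>t\<close> elements. Its colour vectors therefore split \<open>V\<close> into at most \<open>2 ^ t \<le> 2 \<chi>\<close> classes, each of
  size at most \<open>\<gamma>\<close>.\<close>

text \<open>The \<open>LEAST\<close> in \<open>chromatic_number\<close> is attained once some proper
  coloring exists. Giving all vertices distinct colors is one, since every hyperedge has at least
  two vertices.\<close>

lemma chromatic_number_attained: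
  assumes "k \<ge> 2" "uniform_hypergraph k V E"
  obtains f where "proper_coloring V E (chromatic_number V E) f"
proof -
  have fin: "finite V" and edges: "\<And>e. e \<in> E \<Longrightarrow> e \<subseteq> V \<and> card e = k"
    using assms(2) by (auto simp: uniform_hypergraph_def)
  obtain h where h: "bij_betw h V {0..<card V}"
    using ex_bij_betw_finite_nat[OF fin] by blast
  let ?f = "restrict h V"
  have "\<not> monochromatic ?f e" if "e \<in> E" for e
  proof
    assume "monochromatic ?f e"
    then obtain c where "\<forall>v\<in>e. ?f v = c"
      by (auto simp: monochromatic_def)
    then have c: "h v = c" if "v \<in> e" for v
      using that edges[OF \<open>e \<in> E\<close>] by (metis restrict_apply' subsetD)
    \<comment> \<open>Injectivity turns a single color on \<open>e\<close> into
      \<open>card e \<le> 1\<close>, contradicting \<open>k \<ge> 2\<close>.\<close>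
    have "inj_on h e"
      using h edges[OF that] by (meson bij_betw_def inj_on_subset)
    then have "card e = card (h ` e)"
      by (simp add: card_image)
    also have "\<dots> \<le> card {c}"
      using c by (intro card_mono) auto
    finally show False
      using edges[OF that] assms(1) by simp
  qed
  moreover have "?f \<in> V \<rightarrow>\<^sub>E {..<card V}"
    using h by (auto simp: bij_betw_def)
  ultimately have "\<exists>f. proper_coloring V E (card V) f"
    unfolding proper_coloring_def by blast
  then have "\<exists>f. proper_coloring V E (chromatic_number V E) f"
    unfolding chromatic_number_def by (rule LeastI)
  then show thesis
    using that by blast
qed

text \<open>A color below \<open>2 ^ t\<close> is determined by its lowest \<open>t\<close> binary
  digits. If each of these digits were constant on a hyperedge, \<open>f\<close> itself would be
  constant there.\<close>

lemma binary_digits_bicoloring_cover: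
  assumes "proper_coloring V E n f" "n \<le> 2 ^ t" "\<And>e. e \<in> E \<Longrightarrow> e \<subseteq> V"
  shows "bicoloring_cover V E ((\<lambda>i. \<lambda>v\<in>V. of_bool (bit (f v) i)) ` {..<t})"
    (is "bicoloring_cover V E (?X ` _)")
proof -
  have "\<exists>i<t. \<not> monochromatic (?X i) e" if e: "e \<in> E" for e
  proof (rule ccontr)
    assume "\<not> (\<exists>i<t. \<not> monochromatic (?X i) e)"
    then have mono: "monochromatic (?X i) e" if "i < t" for i
      using that by blast
    have "f v = f w" if "v \<in> e" "w \<in> e" for v w
    proof -
      have vw: "v \<in> V" "w \<in> V"
        using that assms(3)[OF e] by auto
      then have "f v < 2 ^ t" "f w < 2 ^ t"
        using assms(1,2) by (fastforce simp: proper_coloring_def PiE_def Pi_def)+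
      \<comment> \<open>Truncation to \<open>t\<close> digits loses nothing, so it suffices to
        compare the digits at positions below \<open>t\<close>.\<close>
      then have take: "take_bit t (f v) = f v" "take_bit t (f w) = f w"
        by (simp_all add: take_bit_nat_eq_self)
      have "bit (f v) i = bit (f w) i" if "i < t" for i
      proof -
        have "?X i v = ?X i w"
          using mono[OF that] \<open>v \<in> e\<close> \<open>w \<in> e\<close> unfolding monochromatic_def by metis
        then show ?thesis
          using vw by (simp add: of_bool_eq_iff)
      qed
      then have "take_bit t (f v) = take_bit t (f w)"
        by (intro bit_eqI) (auto simp: bit_take_bit_iff)
      then show ?thesis
        using take by simp
    qed
    then have "monochromatic f e"
      unfolding monochromatic_def by blast
    then show False
      using assms(1) e by (simp add: proper_coloring_def)
  qed
  then show ?thesis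
    by (auto simp: bicoloring_cover_def bicolorings_def)
qed

lemma bicoloring_cover_number_le:
  "bicoloring_cover V E C \<Longrightarrow> bicoloring_cover_number V E \<le> card C"
  unfolding bicoloring_cover_number_def by (rule Least_le) blast

lemma optimal_cover_exists:
  assumes "bicoloring_cover V E C"
  obtains D where "optimal_cover V E D"
proof -
  have "\<exists>D. bicoloring_cover V E D \<and> card D = bicoloring_cover_number V E"
    unfolding bicoloring_cover_number_def by (rule LeastI) (use assms in blast)
  then show thesis
    using that by (auto simp: optimal_cover_def)
qed

text \<open>The fibers of \<open>color_vector C\<close> partition \<open>V\<close>. There are
  \<open>2 ^ card C\<close> possible vectors, and \<open>cover_gamma V C\<close> is the largest
  fiber size.\<close>

lemma card_le_power_cover_gamma:
  assumes "finite V" "finite C" "C \<subseteq> bicolorings V"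
  shows "card V \<le> 2 ^ card C * cover_gamma V C"
proof -
  let ?B = "C \<rightarrow>\<^sub>E {0, 1 :: nat}"
  let ?cls = "\<lambda>b. {v \<in> V. color_vector C v = b}"
  have fin: "finite ?B"
    using assms(2) by (simp add: finite_PiE)
  have "color_vector C v \<in> ?B" if "v \<in> V" for v
  proof -
    have "X v \<in> {0, 1}" if "X \<in> C" for X
      using that \<open>v \<in> V\<close> assms(3) unfolding bicolorings_def by (meson PiE_mem subsetD)
    then show ?thesis
      by (simp add: color_vector_def)
  qed
  then have "V = (\<Union>b\<in>?B. ?cls b)"
    by blast
  then have "card V \<le> (\<Sum>b\<in>?B. card (?cls b))"
    using card_UN_le[OF fin, of ?cls] by simp
  also have "\<dots> \<le> card ?B * cover_gamma V C"
    using fin sum_bounded_above[of ?B "\<lambda>b. card (?cls b)" "cover_gamma V C"]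
    by (simp add: cover_gamma_def)
  also have "card ?B = 2 ^ card C"
    using assms(2) by (simp add: card_PiE numeral_2_eq_2)
  finally show ?thesis .
qed

text \<open>Bounding an element by \<open>Max\<close> requires a finite set: optimal covers are
  subsets of the finite set \<open>bicolorings V\<close>.\<close>

lemma cover_gamma_le_cover_independence_number:
  assumes "finite V" "optimal_cover V E C"
  shows "cover_gamma V C \<le> cover_independence_number V E"
proof -
  have "finite (bicolorings V)"
    using assms(1) by (simp add: bicolorings_def finite_PiE)
  moreover have "{C. optimal_cover V E C} \<subseteq> Pow (bicolorings V)"
    by (auto simp: optimal_cover_def bicoloring_cover_def)
  ultimately have "finite {C. optimal_cover V E C}"
    by (meson finite_Pow_iff finite_subset)
  then show ?thesis
    unfolding cover_independence_number_def using assms(2) by (intro Max_ge) auto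
qed

theorem theorem8:
  fixes V :: "'a set" and E :: "'a set set" and k :: nat
  assumes "k \<ge> 2" and "uniform_hypergraph k V E"
  shows "real (chromatic_number V E) \<ge>
    real (card V) / (2 * real (cover_independence_number V E))"
proof -
  let ?\<chi> = "chromatic_number V E" and ?\<gamma> = "cover_independence_number V E"
  have fin: "finite V" and edges: "\<And>e. e \<in> E \<Longrightarrow> e \<subseteq> V"
    using assms(2) by (auto simp: uniform_hypergraph_def)
  obtain f where f: "proper_coloring V E ?\<chi> f"
    using chromatic_number_attained[OF assms] .
  have "card V \<le> 2 * ?\<chi> * ?\<gamma>"
  proof (cases "?\<chi> = 0")
    \<comment> \<open>No power of two is at most 0, so this case is separate; a coloring without
      colors forces \<open>V\<close> to be empty.\<close>
    case True
    then have "V = {}"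
      using f by (auto simp: proper_coloring_def)
    then show ?thesis
      by simp
  next
    case False
    \<comment> \<open>The number of digits is \<open>t = n + 1\<close>: the upper bound makes them
      suffice for all colors, the lower bound gives \<open>2 ^ t \<le> 2 * ?\<chi>\<close>.\<close>
    then obtain n where n: "2 ^ n \<le> ?\<chi>" "?\<chi> < 2 ^ (n + 1)"
      using ex_power_ivl1[of 2 ?\<chi>] by auto
    define D where "D = (\<lambda>i. \<lambda>v\<in>V. of_bool (bit (f v) i) :: nat) ` {..<n + 1}"
    have D: "bicoloring_cover V E D"
      unfolding D_def using n by (intro binary_digits_bicoloring_cover[OF f _ edges]) auto
    obtain C where C: "optimal_cover V E C"
      using optimal_cover_exists[OF D] .
    \<comment> \<open>Only an inequality: different digit positions may yield the same
      bicoloring.\<close>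
    have "card D \<le> n + 1"
      unfolding D_def using card_image_le[of "{..<n + 1}"] by fastforce
    then have "card C \<le> n + 1"
      using bicoloring_cover_number_le[OF D] C by (simp add: optimal_cover_def)
    then have "(2::nat) ^ card C \<le> 2 ^ (n + 1)"
      by (intro power_increasing) auto
    also have "\<dots> \<le> 2 * ?\<chi>"
      using n by simp
    finally have "2 ^ card C * cover_gamma V C \<le> 2 * ?\<chi> * ?\<gamma>"
      using cover_gamma_le_cover_independence_number[OF fin C] by (rule mult_le_mono)
    moreover have "card V \<le> 2 ^ card C * cover_gamma V C"
      using C by (intro card_le_power_cover_gamma[OF fin])
        (auto simp: optimal_cover_def bicoloring_cover_def)
    ultimately show ?thesis
      by linarith
  qed
  then have "real (card V) \<le> real (2 * ?\<chi> * ?\<gamma>)"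
    by (rule of_nat_mono)
  then show ?thesis
    \<comment> \<open>If \<open>?\<gamma> = 0\<close>, the quotient is 0 by the convention for
      division by zero.\<close>
    by (cases "?\<gamma> = 0") (auto simp: field_simps)
qed

end
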